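(* Let $2<\alpha<3$ and let $(u,p)$ be a rotational axisymmetric $(-\alpha)$-homogeneous solution of the stationary incompressible Euler equations in $\mathbb{R}^3\setminus\{0\}$ of the form described in the context, with positive profile $w$. If $C_1\neq0$, let $F=\Pi$ be the Bernoulli function; if $C_1=0$, let $F=\varphi$ be the proportionality factor. Then the level sets of $F$ are nested surfaces created by the rotation of the sign "$\infty$" around the $z$-axis. That is: for each nonzero value $c$ of $F$ there is a Jordan curve $J_c\subset\{(z,r): r>0\}\cup\{(0,0)\}$ passing through $(0,0)$ such that $\{x\in\mathbb{R}^3\setminus\{0\}: F(x)=c\}$ is the surface obtained by rotating $J_c\setminus\{(0,0)\}$ around the $z$-axis (so that its meridian section is $J_c$ together with its mirror image across the $z$-axis, two loops meeting only at the origin); and for any two distinct nonzero values $c,c'$ of $F$, one of the sets $J_c\setminus\{(0,0)\}$, $J_{c'}\setminus\{(0,0)\}$ is contained in the bounded domain enclosed by the other Jordan curve.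
   Context: The stationary Euler equations are $u\cdot\nabla u+\nabla p=0$, $\nabla\cdot u=0$. Cylindrical coordinates: $x_1=r\cos\phi$, $x_2=r\sin\phi$, $x_3=z$; polar coordinates in the $(z,r)$-half plane: $z=\rho\cos\theta$, $r=\rho\sin\theta$, $0\leq\theta\leq\pi$. The solutions considered are those with positive stream function given by the Clebsch representation $$u=\nabla\times(\psi\nabla\phi)+\Gamma\nabla\phi,\qquad \psi=\frac{w(\cos\theta)}{\rho^{\beta}},\quad \beta=\alpha-2,\qquad \Pi=C_1|\psi|^{2+\frac4\beta},\quad \Gamma=C_2\psi|\psi|^{\frac1\beta},\quad p=\Pi-\tfrac12|u|^2,$$ where $C_1\leq0$, $C_2\in\mathbb{R}$, $(C_1,C_2)\neq(0,0)$, and $w\in C^2(-1,1)\cap C^1[-1,1]$ is a positive (on $(-1,1)$) solution of $$-w''=\frac{\beta(\beta+1)}{1-t^2}w+c_1w|w|^{\frac4\beta}+\frac{c_2}{1-t^2}w|w|^{\frac2\beta}\ \text{ in }(-1,1),\qquad w(\pm1)=0,$$ with $c_1=-2C_1(1+2/\beta)$, $c_2=C_2^2(1+1/\beta)$. Here $\Pi=p+|u|^2/2$ is the Bernoulli function. For $C_1=0$ the solution is a Beltrami flow, $\nabla\times u=\varphi u$, with proportionality factor $\varphi=C_2\left(1+\frac1{\alpha-2}\right)|\psi|^{\frac1{\alpha-2}}$. *)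

theory Defs
  imports "HOL-Analysis.Analysis"
begin

section \<open>Vector calculus in three dimensions\<close>

definition gradient :: "(real^3 \<Rightarrow> real) \<Rightarrow> real^3 \<Rightarrow> real^3" where
  "gradient f x = (\<chi> i. frechet_derivative f (at x) (axis i 1))"

definition divergence :: "(real^3 \<Rightarrow> real^3) \<Rightarrow> real^3 \<Rightarrow> real" where
  "divergence v x = trace (jacobian v (at x))"

text \<open>In \<open>jacobian v (at x) $ i $ j\<close>, the index \<open>i\<close> is the component and \<open>j\<close> the direction
  of differentiation.\<close>

definition curl :: "(real^3 \<Rightarrow> real^3) \<Rightarrow> real^3 \<Rightarrow> real^3" where
  "curl v x = (let D = jacobian v (at x) in
     vector [D $ 3 $ 2 - D $ 2 $ 3, D $ 1 $ 3 - D $ 3 $ 1, D $ 2 $ 1 - D $ 1 $ 2])"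

section \<open>Solutions of the stationary Euler equations on the punctured space\<close>

text \<open>Classical solutions; continuity of the derivatives is not required.\<close>

definition euler_solution :: "(real^3 \<Rightarrow> real^3) \<Rightarrow> (real^3 \<Rightarrow> real) \<Rightarrow> bool" where
  "euler_solution u p \<longleftrightarrow> (\<forall>x. x \<noteq> 0 \<longrightarrow>
     u differentiable (at x) \<and> p differentiable (at x) \<and>
     jacobian u (at x) *v u x + gradient p x = 0 \<and>
     divergence u x = 0)"

definition rot_z :: "real \<Rightarrow> real^3 \<Rightarrow> real^3" where
  "rot_z a x = vector [x $ 1 * cos a - x $ 2 * sin a, x $ 1 * sin a + x $ 2 * cos a, x $ 3]"

definition axisymmetric :: "(real^3 \<Rightarrow> real^3) \<Rightarrow> (real^3 \<Rightarrow> real) \<Rightarrow> bool" where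
  "axisymmetric u p \<longleftrightarrow> (\<forall>a x. x \<noteq> 0 \<longrightarrow>
     u (rot_z a x) = rot_z a (u x) \<and> p (rot_z a x) = p x)"

text \<open>A \<open>(-\<alpha>)\<close>-homogeneous solution has velocity of degree \<open>-\<alpha>\<close>, hence pressure of degree
  \<open>-2\<alpha>\<close>.\<close>

definition homogeneous :: "real \<Rightarrow> (real^3 \<Rightarrow> real^3) \<Rightarrow> (real^3 \<Rightarrow> real) \<Rightarrow> bool" where
  "homogeneous \<alpha> u p \<longleftrightarrow> (\<forall>s x. s > 0 \<longrightarrow> x \<noteq> 0 \<longrightarrow>
     u (s *\<^sub>R x) = (s powr (-\<alpha>)) *\<^sub>R u x \<and> p (s *\<^sub>R x) = s powr (-2 * \<alpha>) * p x)"

definition rotational :: "(real^3 \<Rightarrow> real^3) \<Rightarrow> bool" where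
  "rotational u \<longleftrightarrow> (\<exists>x. x \<noteq> 0 \<and> curl u x \<noteq> 0)"

definition bernoulli :: "(real^3 \<Rightarrow> real^3) \<Rightarrow> (real^3 \<Rightarrow> real) \<Rightarrow> real^3 \<Rightarrow> real" where
  "bernoulli u p x = p x + (norm (u x))\<^sup>2 / 2"

section \<open>The Clebsch ansatz\<close>

text \<open>Here \<open>w1\<close> and \<open>w2\<close> are the first and second derivatives of \<open>w\<close>;
  \<open>w1\<close> is one-sided at the end points.\<close>

definition positive_profile :: "real \<Rightarrow> real \<Rightarrow> real \<Rightarrow> (real \<Rightarrow> real) \<Rightarrow> bool" where
  "positive_profile \<beta> c1 c2 w \<longleftrightarrow>
     (\<exists>w1 w2.
        (\<forall>t\<in>{-1..1}. (w has_real_derivative w1 t) (at t within {-1..1})) \<and>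
        continuous_on {-1..1} w1 \<and>
        (\<forall>t\<in>{-1<..<1}. (w1 has_real_derivative w2 t) (at t)) \<and>
        continuous_on {-1<..<1} w2 \<and>
        (\<forall>t\<in>{-1<..<1}. - w2 t =
            \<beta> * (\<beta> + 1) / (1 - t\<^sup>2) * w t
            + c1 * w t * \<bar>w t\<bar> powr (4 / \<beta>)
            + c2 / (1 - t\<^sup>2) * w t * \<bar>w t\<bar> powr (2 / \<beta>))) \<and>
     (\<forall>t\<in>{-1<..<1}. w t > 0) \<and>
     w (-1) = 0 \<and> w 1 = 0"

text \<open>\<open>cos \<theta> = z / \<rho>\<close>; on the axis \<open>cos \<theta> = \<plusminus>1\<close>.\<close>

definition stream :: "real \<Rightarrow> (real \<Rightarrow> real) \<Rightarrow> real^3 \<Rightarrow> real" where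
  "stream \<beta> w x = w (x $ 3 / norm x) / norm x powr \<beta>"

text \<open>The gradient of the (multivalued) azimuth \<open>\<phi>\<close>, defined off the axis.\<close>

definition grad_azimuth :: "real^3 \<Rightarrow> real^3" where
  "grad_azimuth x = (1 / ((x $ 1)\<^sup>2 + (x $ 2)\<^sup>2)) *\<^sub>R vector [- x $ 2, x $ 1, 0]"

text \<open>The representation of \<open>u\<close> is imposed off the axis, where the azimuth is defined; on the
  axis \<open>u\<close> is determined by continuity. The pressure is given everywhere.\<close>

definition clebsch_form ::
    "real \<Rightarrow> real \<Rightarrow> real \<Rightarrow> (real \<Rightarrow> real) \<Rightarrow> (real^3 \<Rightarrow> real^3) \<Rightarrow> (real^3 \<Rightarrow> real) \<Rightarrow> bool" where
  "clebsch_form \<beta> C1 C2 w u p \<longleftrightarrow>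
     (\<forall>x. (x $ 1, x $ 2) \<noteq> (0, 0) \<longrightarrow>
        u x = curl (\<lambda>y. stream \<beta> w y *\<^sub>R grad_azimuth y) x
              + (C2 * stream \<beta> w x * \<bar>stream \<beta> w x\<bar> powr (1 / \<beta>)) *\<^sub>R grad_azimuth x) \<and>
     (\<forall>x. x \<noteq> 0 \<longrightarrow>
        p x = C1 * \<bar>stream \<beta> w x\<bar> powr (2 + 4 / \<beta>) - (norm (u x))\<^sup>2 / 2)"

text \<open>For \<open>C1 = 0\<close>, the factor \<open>f\<close> in the Beltrami relation \<open>curl u x = f x *\<^sub>R u x\<close>; it is
  \<open>\<Gamma>'(\<psi>)\<close> for \<open>\<Gamma> = C2 \<psi> \<bar>\<psi>\<bar> powr (1 / \<beta>)\<close>.\<close>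

definition beltrami_factor :: "real \<Rightarrow> real \<Rightarrow> (real \<Rightarrow> real) \<Rightarrow> real^3 \<Rightarrow> real" where
  "beltrami_factor \<beta> C2 w x = C2 * (1 + 1 / \<beta>) * \<bar>stream \<beta> w x\<bar> powr (1 / \<beta>)"

section \<open>Meridian half-plane and surfaces of revolution\<close>

text \<open>A point \<open>(z, r)\<close> of the meridian plane is encoded as the complex number \<open>Complex z r\<close>.
  \<open>from_meridian a\<close> embeds that plane into space at azimuth \<open>a\<close> (for \<open>r < 0\<close>, on the
  opposite side of the axis), so the mirror image across the \<open>z\<close>-axis is \<open>cnj\<close>.\<close>

definition from_meridian :: "real \<Rightarrow> complex \<Rightarrow> real^3" where
  "from_meridian a v = vector [Im v * cos a, Im v * sin a, Re v]"

definition surface_of_revolution :: "complex set \<Rightarrow> (real^3) set" where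
  "surface_of_revolution S = {from_meridian a v | a v. v \<in> S}"

definition jordan_curve :: "complex set \<Rightarrow> bool" where
  "jordan_curve J \<longleftrightarrow> (\<exists>g. simple_path g \<and> pathfinish g = pathstart g \<and> path_image g = J)"

end

theory Submission
  imports Defs
begin

text \<open>Off the origin \<open>F\<close> is \<open>K \<bar>\<psi>\<bar> powr q\<close> with \<open>K \<noteq> 0\<close> and \<open>q > 0\<close>, so its nonzero level sets are the level
  sets \<open>\<psi> = s\<close> with \<open>s > 0\<close>. In polar coordinates of the meridian half-plane such a level set is the graph
  \<open>\<rho> = (w (cos \<theta>) / s) powr (1 / \<beta>)\<close>, which closes up at the origin because \<open>w\<close> vanishes at \<open>\<plusminus>1\<close>.
  The superlevel set \<open>\<psi> > s\<close> is open and bounded with frontier in the closed loop, hence lies inside it.\<close>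

text \<open>The equation \<psi> = s multiplied by \<open>cmod v powr \<beta>\<close>, with
  \<open>Re v / cmod v\<close> in the role of cos \<theta>. The condition \<open>Im v > 0\<close>
  leaves out the origin, which is inserted separately to close the curve.\<close>

definition meridian_level :: "real \<Rightarrow> (real \<Rightarrow> real) \<Rightarrow> real \<Rightarrow> complex set" where
  "meridian_level \<beta> w s = {v. Im v > 0 \<and> w (Re v / cmod v) = s * cmod v powr \<beta>}"

definition meridian_superlevel :: "real \<Rightarrow> (real \<Rightarrow> real) \<Rightarrow> real \<Rightarrow> complex set" where
  "meridian_superlevel \<beta> w s = {v. Im v > 0 \<and> w (Re v / cmod v) > s * cmod v powr \<beta>}"

section \<open>Coordinates in the meridian plane\<close>

lemma Re_div_cmod_mem: "Re v / cmod v \<in> {-1..1}"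
  \<comment> \<open>At \<open>v = 0\<close> the quotient is 0 by convention, which lies in the
    interval as well.\<close>
  using abs_Re_le_cmod[of v] by (cases "v = 0") (auto simp: field_simps abs_le_iff)

lemma Re_div_cmod_real: "Im v = 0 \<Longrightarrow> v \<noteq> 0 \<Longrightarrow> Re v / cmod v = 1 \<or> Re v / cmod v = -1"
  by (auto simp: cmod_eq_Re complex_eq_iff abs_if)

lemma norm_from_meridian [simp]: "norm (from_meridian a v) = cmod v"
proof -
  have "(Im v * cos a)\<^sup>2 + (Im v * sin a)\<^sup>2 = (Im v)\<^sup>2"
    by (simp add: power_mult_distrib flip: distrib_left)
  then show ?thesis
    by (simp add: from_meridian_def norm_vec_def L2_set_def sum_3 cmod_def add.commute)
qed

lemma from_meridian_eq_0_iff [simp]: "from_meridian a v = 0 \<longleftrightarrow> v = 0"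
  by (metis norm_eq_zero norm_from_meridian)

lemma stream_from_meridian:
  "stream \<beta> w (from_meridian a v) = w (Re v / cmod v) / cmod v powr \<beta>"
proof -
  have "from_meridian a v $ 3 = Re v" by (simp add: from_meridian_def)
  then show ?thesis by (simp add: stream_def)
qed

lemma from_meridian_surj: "\<exists>a v. Im v \<ge> 0 \<and> x = from_meridian a v"
proof -
  \<comment> \<open>The azimuth is the argument of \<open>y\<close>. On the axis
    \<open>cmod y = 0\<close>, so any value of \<open>Arg y\<close> serves there.\<close>
  define y where "y = Complex (x $ 1) (x $ 2)"
  have "y = rcis (cmod y) (Arg y)" by (simp add: rcis_cmod_Arg)
  then have "x $ 1 = cmod y * cos (Arg y)" "x $ 2 = cmod y * sin (Arg y)"
    by (metis Re_rcis complex.sel(1) y_def, metis Im_rcis complex.sel(2) y_def)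
  then have "x = from_meridian (Arg y) (Complex (x $ 3) (cmod y))"
    by (simp add: from_meridian_def vec_eq_iff forall_3)
  then show ?thesis by (metis complex.sel(2) norm_ge_zero)
qed

lemma powr_eq_iff_eq_powr_inverse:
  fixes x y q :: real
  assumes "q > 0" "y > 0" "x \<ge> 0"
  shows "x powr q = y \<longleftrightarrow> x = y powr (1 / q)"
proof
  assume "x powr q = y"
  then have "y powr (1 / q) = (x powr q) powr (1 / q)" by simp
  then show "x = y powr (1 / q)" using assms by (simp add: powr_powr)
qed (use assms in \<open>simp add: powr_powr\<close>)

section \<open>Level sets of the stream function of a positive profile\<close>

locale profile =
  fixes \<beta> :: real and w :: "real \<Rightarrow> real"
  assumes beta_pos: "\<beta> > 0"
    and continuous: "continuous_on {-1..1} w"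
    and positive: "t \<in> {-1<..<1} \<Longrightarrow> w t > 0"
    and left_end [simp]: "w (-1) = 0" and right_end [simp]: "w 1 = 0"
begin

lemma nonneg: "t \<in> {-1..1} \<Longrightarrow> w t \<ge> 0"
  using positive[of t] by (cases "t = 1 \<or> t = -1") force+

text \<open>Lets the absolute values in the formulas for the Bernoulli function and the
  proportionality factor be dropped.\<close>

lemma stream_nonneg: "stream \<beta> w x \<ge> 0"
  using from_meridian_surj[of x] nonneg[OF Re_div_cmod_mem]
  by (auto simp: stream_from_meridian)

lemma stream_from_meridian_eq_iff:
  assumes "v \<noteq> 0"
  shows "stream \<beta> w (from_meridian a v) = s \<longleftrightarrow> w (Re v / cmod v) = s * cmod v powr \<beta>"
  using assms by (simp add: stream_from_meridian field_simps)

text \<open>On the axis the angle variable is \<plusminus>1, where \<open>w\<close> vanishes, while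
  the right-hand side is positive away from the origin. So positive levels miss the axis.\<close>

lemma profile_Im_nz: "s > 0 \<Longrightarrow> v \<noteq> 0 \<Longrightarrow> w (Re v / cmod v) = s * cmod v powr \<beta> \<Longrightarrow> Im v \<noteq> 0"
  using Re_div_cmod_real[of v] by (metis left_end right_end less_irrefl mult_pos_pos
      powr_gt_zero zero_less_norm_iff norm_eq_zero)

lemma stream_level_surface:
  assumes "s > 0"
  shows "{x. x \<noteq> 0 \<and> stream \<beta> w x = s} = surface_of_revolution (meridian_level \<beta> w s)"
proof (intro equalityI subsetI)
  fix x assume x: "x \<in> {x. x \<noteq> 0 \<and> stream \<beta> w x = s}"
  obtain a v where v: "Im v \<ge> 0" "x = from_meridian a v"
    using from_meridian_surj by blast
  with x have "v \<noteq> 0" by auto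
  moreover from this have "w (Re v / cmod v) = s * cmod v powr \<beta>"
    using x v stream_from_meridian_eq_iff[of v a s] by simp
  ultimately show "x \<in> surface_of_revolution (meridian_level \<beta> w s)"
    using profile_Im_nz[OF assms] v
    by (force simp: surface_of_revolution_def meridian_level_def)
next
  fix x assume "x \<in> surface_of_revolution (meridian_level \<beta> w s)"
  then obtain a v where v: "x = from_meridian a v" "v \<in> meridian_level \<beta> w s"
    by (auto simp: surface_of_revolution_def)
  then have "v \<noteq> 0" by (auto simp: meridian_level_def)
  with v show "x \<in> {x. x \<noteq> 0 \<and> stream \<beta> w x = s}"
    by (simp add: stream_from_meridian_eq_iff meridian_level_def)
qed

text \<open>The stream function sees \<open>v\<close> only through \<open>Re v\<close> and
  \<open>cmod v\<close>, which conjugation preserves, so every section is symmetric about the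
  axis.\<close>

lemma stream_level_meridian_section:
  assumes "s > 0"
  shows "{v. v \<noteq> 0 \<and> stream \<beta> w (from_meridian a v) = s}
    = meridian_level \<beta> w s \<union> cnj ` meridian_level \<beta> w s"
proof -
  have "v \<in> cnj ` meridian_level \<beta> w s \<longleftrightarrow> cnj v \<in> meridian_level \<beta> w s" for v
    by (metis complex_cnj_cnj image_iff)
  then have "v \<in> meridian_level \<beta> w s \<union> cnj ` meridian_level \<beta> w s
      \<longleftrightarrow> Im v \<noteq> 0 \<and> w (Re v / cmod v) = s * cmod v powr \<beta>" for v
    by (auto simp: meridian_level_def)
  moreover have "v \<noteq> 0 \<and> stream \<beta> w (from_meridian a v) = s
      \<longleftrightarrow> Im v \<noteq> 0 \<and> w (Re v / cmod v) = s * cmod v powr \<beta>" for v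
    using profile_Im_nz[OF assms, of v] stream_from_meridian_eq_iff[of v a s] by fastforce
  ultimately show ?thesis by blast
qed

section \<open>Level curves closed up at the origin are Jordan curves\<close>

lemma jordan_curve_meridian_level:
  assumes "s > 0"
  shows "jordan_curve (insert 0 (meridian_level \<beta> w s))"
proof -
  \<comment> \<open>\<open>R\<close> gives the radius in terms of cos \<theta>; \<open>g\<close>
    runs through the curve with polar angle \<theta> = \<pi> t as parameter.\<close>
  define R where "R x = (w x / s) powr (1 / \<beta>)" for x
  define g where "g t = complex_of_real (R (cos (pi * t))) * cis (pi * t)" for t
  have R_pos: "R x > 0" if "x \<in> {-1<..<1}" for x
    using positive[OF that] assms by (simp add: R_def)
  have cos_open: "cos (pi * t) \<in> {-1<..<1}" if "t \<in> {0<..<1}" for t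
    using that cos_monotone_0_pi[of 0 "pi * t"] cos_monotone_0_pi[of "pi * t" pi] by auto
  have g0: "g 0 = 0" "g 1 = 0" by (auto simp: g_def R_def)
  have cmod_g: "cmod (g t) = R (cos (pi * t))" for t
    by (simp add: g_def R_def norm_mult)
  have g_nz: "g t \<noteq> 0" if "t \<in> {0<..<1}" for t
    using R_pos[OF cos_open[OF that]] cmod_g[of t] by auto
  have angle: "Re (g t) / cmod (g t) = cos (pi * t)" if "t \<in> {0<..<1}" for t
    using R_pos[OF cos_open[OF that]] unfolding cmod_g by (simp add: g_def)
  \<comment> \<open>At the zeros of \<open>w\<close> continuity of the power rests on a nonnegative
    base and a positive exponent.\<close>
  have "continuous_on {-1..1} R"
    unfolding R_def using nonneg assms beta_pos
    by (intro continuous_on_powr' continuous_intros continuous) auto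
  then have "continuous_on {0..1} (\<lambda>t. R (cos (pi * t)))"
    by (rule continuous_on_compose2) (auto intro!: continuous_intros)
  then have "path g"
    unfolding path_def g_def by (intro continuous_intros) auto
  moreover have "loop_free g"
    unfolding loop_free_def
  proof (intro ballI impI)
    fix x y :: real assume xy: "x \<in> {0..1}" "y \<in> {0..1}" and eq: "g x = g y"
    show "x = y \<or> x = 0 \<and> y = 1 \<or> x = 1 \<and> y = 0"
    proof (cases "x \<in> {0<..<1} \<and> y \<in> {0<..<1}")
      case True
      \<comment> \<open>A nonzero point determines the cosine of its angle, and \<open>cos\<close>
        is injective on [0, \<pi>].\<close>
      then have "cos (pi * x) = cos (pi * y)" using eq angle by metis
      then have "pi * x = pi * y"
        using True by (intro cos_inj_pi[of "pi * x" "pi * y"]) auto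
      then show ?thesis by simp
    next
      case False
      \<comment> \<open>One parameter is an end point, so the common value is 0; \<open>g\<close>
        has no zero in between, hence both are end points.\<close>
      then have "x \<in> {0, 1} \<or> y \<in> {0, 1}" using xy by auto
      then have "g x = 0" "g y = 0" using eq g0 by auto
      then have "x \<in> {0, 1}" "y \<in> {0, 1}"
        using g_nz[of x] g_nz[of y] xy by (force simp: order_le_less)+
      then show ?thesis by auto
    qed
  qed
  moreover have "path_image g = insert 0 (meridian_level \<beta> w s)"
  proof (intro equalityI subsetI)
    fix v assume "v \<in> path_image g"
    then obtain t where t: "t \<in> {0..1}" "v = g t" by (auto simp: path_image_def)
    show "v \<in> insert 0 (meridian_level \<beta> w s)"
    proof (cases "t \<in> {0<..<1}")
      case True
      have "Im v > 0"
        using True R_pos[OF cos_open[OF True]] t sin_gt_zero[of "pi * t"] by (simp add: g_def)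
      moreover have "cmod v powr \<beta> = w (cos (pi * t)) / s"
        using beta_pos positive[OF cos_open[OF True]] assms
        by (simp add: t cmod_g R_def powr_powr)
      ultimately show ?thesis
        using angle[OF True] t assms by (simp add: meridian_level_def)
    next
      case False
      then show ?thesis using t g0 by (cases "t = 0") auto
    qed
  next
    fix v assume v: "v \<in> insert 0 (meridian_level \<beta> w s)"
    show "v \<in> path_image g"
    proof (cases "v = 0")
      case True
      then show ?thesis using g0(1) by (force simp: path_image_def)
    next
      case False
      with v have im: "Im v > 0" and eq: "w (Re v / cmod v) = s * cmod v powr \<beta>"
        by (auto simp: meridian_level_def)
      \<comment> \<open>The parameter is the polar angle over \<pi>; \<open>Im v > 0\<close> puts
        \<open>Arg v\<close> strictly between 0 and \<pi>.\<close>
      define t where "t = Arg v / pi"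
      have t: "pi * t = Arg v" by (simp add: t_def)
      have "Arg v \<in> {0<..<pi}" using im Arg_lt_pi[of v] by auto
      then have "t \<in> {0..1}" by (auto simp: t_def)
      moreover have "cos (Arg v) = Re v / cmod v"
        using False by (simp add: cos_Arg)
      then have "R (cos (Arg v)) = cmod v"
        using beta_pos eq assms False by (simp add: R_def powr_powr)
      then have "g t = v"
        using rcis_cmod_Arg[of v] by (simp add: g_def t rcis_def)
      ultimately show ?thesis by (auto simp: path_image_def)
    qed
  qed
  ultimately show ?thesis
    unfolding jordan_curve_def simple_path_def using g0
    by (intro exI[of _ g]) (auto simp: pathstart_def pathfinish_def)
qed

section \<open>Nesting of the level curves\<close>

lemma meridian_superlevel_subset_inside:
  assumes "s > 0"
  shows "meridian_superlevel \<beta> w s \<subseteq> inside (insert 0 (meridian_level \<beta> w s))"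
proof -
  \<comment> \<open>Off the origin \<open>h\<close> has the sign of \<psi> - s. Continuity is
    claimed only there, since the angle has no limit at 0.\<close>
  define h where "h v = w (Re v / cmod v) - s * cmod v powr \<beta>" for v
  define D where "D = meridian_superlevel \<beta> w s"
  have D_eq: "D = {v. Im v > 0 \<and> h v > 0}"
    by (auto simp: D_def meridian_superlevel_def h_def)
  have h_cont: "continuous_on (- {0}) h"
    unfolding h_def using beta_pos Re_div_cmod_mem
    by (intro continuous_intros continuous_on_compose2[OF continuous] continuous_on_powr') auto
  have "open D"
  proof -
    have "continuous_on {v. Im v > 0} h"
      by (rule continuous_on_subset[OF h_cont]) auto
    then have "open ({v. Im v > 0} \<inter> h -` {0<..})"
      by (intro continuous_open_preimage) (auto simp: open_halfspace_Im_gt)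
    moreover have "{v. Im v > 0} \<inter> h -` {0<..} = D" by (auto simp: D_eq)
    ultimately show ?thesis by simp
  qed
  have "bounded D"
  proof -
    have "bounded (w ` {-1..1})"
      by (intro compact_imp_bounded compact_continuous_image continuous) auto
    then obtain B where B: "\<And>t. t \<in> {-1..1} \<Longrightarrow> \<bar>w t\<bar> \<le> B"
      by (auto simp: bounded_iff) (metis atLeastAtMost_iff)
    have "cmod v \<le> (B / s) powr (1 / \<beta>)" if "v \<in> D" for v
    proof -
      have "s * cmod v powr \<beta> < B"
        using that B[OF Re_div_cmod_mem[of v]] by (auto simp: D_eq h_def)
      then have "cmod v powr \<beta> \<le> B / s" using assms by (simp add: field_simps)
      then have "(cmod v powr \<beta>) powr (1 / \<beta>) \<le> (B / s) powr (1 / \<beta>)"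
        using beta_pos by (intro powr_mono2) auto
      then show ?thesis using beta_pos by (simp add: powr_powr)
    qed
    then show ?thesis by (auto simp: bounded_iff)
  qed
  have "frontier D \<subseteq> insert 0 (meridian_level \<beta> w s)"
  proof
    fix v assume "v \<in> frontier D"
    then have cl: "v \<in> closure D" and nD: "v \<notin> D"
      using \<open>open D\<close> by (auto simp: frontier_def interior_open)
    show "v \<in> insert 0 (meridian_level \<beta> w s)"
    proof (cases "v = 0")
      case False
      \<comment> \<open>The inequality \<open>h v \<ge> 0\<close> passes to limits within the
        punctured plane; \<open>T\<close> is a closed set of the whole plane with the same trace
        there.\<close>
      have "closedin (top_of_set (- {0})) (- {0} \<inter> h -` {0..})"
        by (rule continuous_closedin_preimage[OF h_cont]) simp
      then obtain T where T: "closed T" "- {0} \<inter> h -` {0..} = - {0} \<inter> T"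
        by (auto simp: closedin_closed)
      have "D \<subseteq> T \<inter> {v. Im v \<ge> 0}" using T(2) by (fastforce simp: D_eq)
      then have "closure D \<subseteq> T \<inter> {v. Im v \<ge> 0}"
        using T(1) by (intro closure_minimal closed_Int) (auto simp: closed_halfspace_Im_ge)
      then have v: "h v \<ge> 0" "Im v \<ge> 0" using cl T(2) False by auto
      \<comment> \<open>On the axis away from the origin \<open>w\<close> vanishes, which would make
        \<open>h v\<close> negative.\<close>
      have "Im v \<noteq> 0"
      proof
        assume "Im v = 0"
        then have "w (Re v / cmod v) = 0" using Re_div_cmod_real[of v] False by auto
        then have "s * cmod v powr \<beta> \<le> 0" using v(1) by (simp add: h_def)
        then show False using assms False by (simp add: mult_le_0_iff)
      qed
      then have "Im v > 0" "h v = 0" using v nD by (auto simp: D_eq)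
      then show ?thesis by (simp add: meridian_level_def h_def)
    qed simp
  qed
  \<comment> \<open>Enlarging the frontier to the whole loop costs at most points of the loop
    itself, and \<open>D\<close> contains none of these.\<close>
  then have "inside (frontier D) - insert 0 (meridian_level \<beta> w s)
      \<subseteq> inside (insert 0 (meridian_level \<beta> w s))"
    by (rule inside_mono)
  moreover have "D \<subseteq> inside (frontier D)"
    using interior_inside_frontier[OF \<open>bounded D\<close>] \<open>open D\<close> by (simp add: interior_open)
  moreover have "D \<inter> insert 0 (meridian_level \<beta> w s) = {}"
    by (auto simp: D_eq meridian_level_def h_def)
  ultimately show ?thesis unfolding D_def by blast
qed

text \<open>On the curve of level \<open>s\<close> the value of \<open>w\<close> exceeds
  \<open>s' * cmod v powr \<beta>\<close>, so the curve lies in the superlevel set of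
  \<open>s'\<close>: higher levels lie further in.\<close>

lemma meridian_level_subset_inside:
  assumes "0 < s'" "s' < s"
  shows "meridian_level \<beta> w s \<subseteq> inside (insert 0 (meridian_level \<beta> w s'))"
proof -
  have "meridian_level \<beta> w s \<subseteq> meridian_superlevel \<beta> w s'"
    using assms by (fastforce simp: meridian_level_def meridian_superlevel_def
        intro: mult_strict_right_mono)
  then show ?thesis using meridian_superlevel_subset_inside[OF assms(1)] by blast
qed

end

section \<open>Transfer from the stream function to \<open>F\<close>\<close>

theorem corollary1p11:
  fixes \<alpha> \<beta> C1 C2 :: real
    and w :: "real \<Rightarrow> real"
    and u :: "real^3 \<Rightarrow> real^3"
    and p F :: "real^3 \<Rightarrow> real"
  assumes "2 < \<alpha>" and "\<alpha> < 3" and "\<beta> = \<alpha> - 2"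
    and "C1 \<le> 0" and "(C1, C2) \<noteq> (0, 0)"
    and "positive_profile \<beta> (- 2 * C1 * (1 + 2 / \<beta>)) (C2\<^sup>2 * (1 + 1 / \<beta>)) w"
    and "euler_solution u p" and "axisymmetric u p" and "homogeneous \<alpha> u p" and "rotational u"
    and "clebsch_form \<beta> C1 C2 w u p"
    and "F = (if C1 \<noteq> 0 then bernoulli u p else beltrami_factor \<beta> C2 w)"
  shows "\<exists>J :: real \<Rightarrow> complex set.
    (\<forall>c \<in> F ` (- {0}) - {0}.
        jordan_curve (J c) \<and> 0 \<in> J c \<and> J c \<subseteq> {v. Im v > 0} \<union> {0} \<and>
        {x. x \<noteq> 0 \<and> F x = c} = surface_of_revolution (J c - {0}) \<and>
        (\<forall>a. {v. v \<noteq> 0 \<and> F (from_meridian a v) = c} \<union> {0} = J c \<union> cnj ` J c) \<and>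
        J c \<inter> cnj ` J c = {0}) \<and>
    (\<forall>c \<in> F ` (- {0}) - {0}. \<forall>c' \<in> F ` (- {0}) - {0}. c \<noteq> c' \<longrightarrow>
        J c - {0} \<subseteq> inside (J c') \<or> J c' - {0} \<subseteq> inside (J c))"
proof -
  have beta: "\<beta> > 0" using assms by simp
  interpret profile \<beta> w
  proof
    obtain w1 where "\<forall>t\<in>{-1..1}. (w has_real_derivative w1 t) (at t within {-1..1})"
      using assms(6) by (auto simp: positive_profile_def)
    then show "continuous_on {-1..1} w"
      by (meson DERIV_continuous continuous_on_eq_continuous_within)
  qed (use assms(6) beta in \<open>auto simp: positive_profile_def\<close>)
  obtain K q where K: "K \<noteq> 0" and q: "q > 0"
    and F: "\<And>x. x \<noteq> 0 \<Longrightarrow> F x = K * stream \<beta> w x powr q"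
  proof (cases "C1 = 0")
    case True
    show ?thesis
    proof (rule that)
      show "C2 * (1 + 1 / \<beta>) \<noteq> 0" using True assms(5) beta by (simp add: add_nonneg_eq_0_iff)
      show "1 / \<beta> > 0" using beta by simp
      show "F x = C2 * (1 + 1 / \<beta>) * stream \<beta> w x powr (1 / \<beta>)" for x
        using True assms(12) stream_nonneg[of x] by (simp add: beltrami_factor_def)
    qed
  next
    case False
    show ?thesis
    proof (rule that)
      show "C1 \<noteq> 0" by fact
      show "2 + 4 / \<beta> > 0" using beta by (simp add: add_pos_pos)
      \<comment> \<open>The kinetic term of the Bernoulli function cancels against the one in the
        pressure formula.\<close>
      show "F x = C1 * stream \<beta> w x powr (2 + 4 / \<beta>)" if "x \<noteq> 0" for x
        using that False assms(11,12) stream_nonneg[of x]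
        by (simp add: bernoulli_def clebsch_form_def)
    qed
  qed
  \<comment> \<open>\<open>S c\<close> solves \<open>K * s powr q = c\<close> for \<open>s\<close>.
    A nonzero value \<open>c\<close> of \<open>F\<close> has the sign of \<open>K\<close>, so the
    base \<open>c / K\<close> is positive even when \<open>K\<close> is negative.\<close>
  define S where "S c = (c / K) powr (1 / q)" for c
  define J where "J c = insert 0 (meridian_level \<beta> w (S c))" for c
  have ratio_pos: "c / K > 0" if "c \<in> F ` (- {0}) - {0}" for c
  proof -
    from that obtain x where "x \<noteq> 0" "c = K * stream \<beta> w x powr q" "c \<noteq> 0"
      by (metis ComplD DiffD1 DiffD2 F imageE singletonI)
    then show ?thesis using K by (simp add: order_le_less)
  qed
  have S_pos: "S c > 0" if "c \<in> F ` (- {0}) - {0}" for c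
    unfolding S_def using ratio_pos[OF that] by (metis powr_gt_zero less_irrefl)
  have F_iff: "F x = c \<longleftrightarrow> stream \<beta> w x = S c"
    if "c \<in> F ` (- {0}) - {0}" "x \<noteq> 0" for c x
  proof -
    have "F x = c \<longleftrightarrow> stream \<beta> w x powr q = c / K"
      using K F[OF that(2)] by (auto simp: field_simps)
    also have "\<dots> \<longleftrightarrow> stream \<beta> w x = S c"
      unfolding S_def using q ratio_pos[OF that(1)] stream_nonneg[of x]
      by (rule powr_eq_iff_eq_powr_inverse)
    finally show ?thesis .
  qed
  \<comment> \<open>If the levels agreed, a point where \<open>F\<close> takes the value
    \<open>c\<close> would also give \<open>c'\<close>.\<close>
  have S_inj: "S c \<noteq> S c'"
    if "c \<in> F ` (- {0}) - {0}" "c' \<in> F ` (- {0}) - {0}" "c \<noteq> c'" for c c'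
    using that F_iff by (metis (no_types, lifting) ComplD DiffD1 imageE singletonI)
  have J_diff: "J c - {0} = meridian_level \<beta> w (S c)" for c
    by (auto simp: J_def meridian_level_def)
  show ?thesis
  proof (intro exI[of _ J] conjI ballI impI allI)
    fix c assume c: "c \<in> F ` (- {0}) - {0}"
    note s = S_pos[OF c]
    show "jordan_curve (J c)"
      unfolding J_def by (rule jordan_curve_meridian_level[OF s])
    show "0 \<in> J c" by (simp add: J_def)
    show "J c \<subseteq> {v. Im v > 0} \<union> {0}" by (auto simp: J_def meridian_level_def)
    show "{x. x \<noteq> 0 \<and> F x = c} = surface_of_revolution (J c - {0})"
      unfolding J_diff stream_level_surface[OF s, symmetric] using F_iff[OF c] by auto
    show "{v. v \<noteq> 0 \<and> F (from_meridian a v) = c} \<union> {0} = J c \<union> cnj ` J c" for a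
    proof -
      have "{v. v \<noteq> 0 \<and> F (from_meridian a v) = c}
          = {v. v \<noteq> 0 \<and> stream \<beta> w (from_meridian a v) = S c}"
        by (intro Collect_cong conj_cong refl F_iff[OF c]) simp
      then show ?thesis by (auto simp: J_def stream_level_meridian_section[OF s])
    qed
    show "J c \<inter> cnj ` J c = {0}" by (auto simp: J_def meridian_level_def)
  next
    fix c c' assume "c \<in> F ` (- {0}) - {0}" "c' \<in> F ` (- {0}) - {0}" "c \<noteq> c'"
    \<comment> \<open>The levels \<open>S c\<close> and \<open>S c'\<close> are compared instead of
      \<open>c\<close> and \<open>c'\<close>, whose order is reversed for negative \<open>K\<close>;
      the smaller level gives the outer curve.\<close>
    then have "S c > 0" "S c' > 0" "S c < S c' \<or> S c' < S c"
      using S_pos S_inj by (auto simp: neq_iff)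
    then show "J c - {0} \<subseteq> inside (J c') \<or> J c' - {0} \<subseteq> inside (J c)"
      unfolding J_diff using meridian_level_subset_inside by (metis J_def)
  qed
qed

end
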